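(* Let $|A|=n$. (i) The cardinality of $\mathrm{Styl}(A)$ is the Bell number $B_{n+1}$ (the number of partitions of a set with $n+1$ elements). (ii) $\mathrm{Styl}(A)$ is presented by generators $A$ subject to the plactic relations $bac=bca$, $acb=cab$ for all letters $a<b<c$, $baa=aba$, $bba=bab$ for all letters $a<b$, together with the relations $x^2=x$ for all $x\in A$.
   Context: $A$ is a finite totally ordered alphabet and $A^*$ the free monoid on $A$. A column is a subset of $A$, identified with the strictly decreasing word of its elements. For a column $\gamma$ and a letter $x$: if $x>y$ for all $y\in\gamma$, let $x\cdot\gamma=\gamma\cup\{x\}$; otherwise let $y$ be the smallest element of $\gamma$ with $y\geq x$ and let $x\cdot\gamma=(\gamma\setminus\{y\})\cup\{x\}$. This extends to a left action of $A^*$ on the set of columns by $(uv)\cdot\gamma=u\cdot(v\cdot\gamma)$. $\mathrm{Styl}(A)$ (the stylic monoid) is the monoid of maps of the set of columns to itself induced by the words under this action; equivalently it is $A^*$ modulo the congruence $u\equiv_{styl}v$ iff $u\cdot\gamma=v\cdot\gamma$ for all columns $\gamma$. *)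

theory Defs
  imports "HOL-Algebra.Group" "HOL-Library.Disjoint_Sets"
begin

definition bell :: "nat \<Rightarrow> nat" where
  "bell n = card {P. partition_on {..<n} P}"

text \<open>The alphabet is a finite subset \<open>A\<close> of a linearly ordered type, so that the empty
  alphabet is allowed. The free monoid on \<open>A\<close> is \<open>lists A\<close>, and a column is an
  element of \<open>Pow A\<close>.\<close>

definition letter_act :: "'a::linorder \<Rightarrow> 'a set \<Rightarrow> 'a set" where
  "letter_act x \<gamma> =
     (if \<forall>y\<in>\<gamma>. y < x then \<gamma> \<union> {x}
      else (\<gamma> - {Min {y\<in>\<gamma>. x \<le> y}}) \<union> {x})"

fun word_act :: "'a::linorder list \<Rightarrow> 'a set \<Rightarrow> 'a set" where
  "word_act [] \<gamma> = \<gamma>"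
| "word_act (x # w) \<gamma> = letter_act x (word_act w \<gamma>)"

text \<open>The map of \<open>Pow A\<close> to itself induced by a word; \<open>restrict\<close> makes it
  \<open>undefined\<close> off \<open>Pow A\<close>, so that equality means equality on all columns over \<open>A\<close>.\<close>

definition styl_map :: "'a::linorder set \<Rightarrow> 'a list \<Rightarrow> 'a set \<Rightarrow> 'a set" where
  "styl_map A w = restrict (word_act w) (Pow A)"

definition Styl :: "'a::linorder set \<Rightarrow> ('a set \<Rightarrow> 'a set) monoid" where
  "Styl A = \<lparr>carrier = styl_map A ` lists A,
             monoid.mult = compose (Pow A),
             one = (\<lambda>\<gamma>\<in>Pow A. \<gamma>)\<rparr>"

lemma word_act_append: "word_act (u @ v) \<gamma> = word_act u (word_act v \<gamma>)"
  by (induction u) auto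

lemma letter_act_closed:
  assumes "x \<in> A" "\<gamma> \<in> Pow A"
  shows "letter_act x \<gamma> \<in> Pow A"
  using assms by (auto simp: letter_act_def)

lemma word_act_closed:
  assumes "w \<in> lists A" "\<gamma> \<in> Pow A"
  shows "word_act w \<gamma> \<in> Pow A"
  using assms by (induction w) (simp_all add: letter_act_closed del: Pow_iff)

lemma styl_map_eq_iff:
  "styl_map A u = styl_map A v \<longleftrightarrow> (\<forall>\<gamma>\<in>Pow A. word_act u \<gamma> = word_act v \<gamma>)"
  unfolding styl_map_def by (metis restrict_apply' restrict_ext)

lemma styl_map_append:
  assumes "v \<in> lists A"
  shows "styl_map A (u @ v) = compose (Pow A) (styl_map A u) (styl_map A v)"
  using word_act_closed[OF assms]
  by (auto simp: styl_map_def compose_def word_act_append fun_eq_iff restrict_def)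

lemma styl_map_Nil: "styl_map A [] = (\<lambda>\<gamma>\<in>Pow A. \<gamma>)"
  by (auto simp: styl_map_def fun_eq_iff restrict_def)

lemma monoid_Styl: "monoid (Styl A)"
proof (rule monoidI)
  fix f g assume "f \<in> carrier (Styl A)" "g \<in> carrier (Styl A)"
  then obtain u v where "u \<in> lists A" "v \<in> lists A" "f = styl_map A u" "g = styl_map A v"
    by (auto simp: Styl_def)
  then show "f \<otimes>\<^bsub>Styl A\<^esub> g \<in> carrier (Styl A)"
    using styl_map_append[of v A u] by (auto simp: Styl_def intro!: image_eqI[of _ _ "u @ v"])
next
  show "\<one>\<^bsub>Styl A\<^esub> \<in> carrier (Styl A)"
    using styl_map_Nil[of A] by (auto simp: Styl_def intro!: image_eqI[of _ _ "[]"])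
next
  fix f g h assume "f \<in> carrier (Styl A)" "g \<in> carrier (Styl A)" "h \<in> carrier (Styl A)"
  then obtain u v w where "u \<in> lists A" "v \<in> lists A" "w \<in> lists A"
    "f = styl_map A u" "g = styl_map A v" "h = styl_map A w"
    by (auto simp: Styl_def)
  then show "f \<otimes>\<^bsub>Styl A\<^esub> g \<otimes>\<^bsub>Styl A\<^esub> h = f \<otimes>\<^bsub>Styl A\<^esub> (g \<otimes>\<^bsub>Styl A\<^esub> h)"
    by (simp add: Styl_def flip: styl_map_append)
next
  fix f assume "f \<in> carrier (Styl A)"
  then obtain u where "u \<in> lists A" "f = styl_map A u"
    by (auto simp: Styl_def)
  then show "\<one>\<^bsub>Styl A\<^esub> \<otimes>\<^bsub>Styl A\<^esub> f = f" "f \<otimes>\<^bsub>Styl A\<^esub> \<one>\<^bsub>Styl A\<^esub> = f"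
    by (simp_all add: Styl_def flip: styl_map_append styl_map_Nil)
qed

text \<open>The congruence on the free monoid \<open>lists A\<close> generated by a set \<open>R\<close> of
  pairs of words over \<open>A\<close>.\<close>

inductive_set gen_cong :: "'a set \<Rightarrow> ('a list \<times> 'a list) set \<Rightarrow> ('a list \<times> 'a list) set"
  for A R where
  base: "(u, v) \<in> R \<Longrightarrow> (u, v) \<in> gen_cong A R"
| refl: "u \<in> lists A \<Longrightarrow> (u, u) \<in> gen_cong A R"
| sym: "(u, v) \<in> gen_cong A R \<Longrightarrow> (v, u) \<in> gen_cong A R"
| trans: "(u, v) \<in> gen_cong A R \<Longrightarrow> (v, w) \<in> gen_cong A R \<Longrightarrow> (u, w) \<in> gen_cong A R"
| mult: "(u, v) \<in> gen_cong A R \<Longrightarrow> (u', v') \<in> gen_cong A R \<Longrightarrow> (u @ u', v @ v') \<in> gen_cong A R"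

text \<open>The quotient monoid \<open>A\<^sup>* / R\<close>. All words \<open>u @ v\<close> with \<open>u \<in> C\<close>, \<open>v \<in> D\<close> lie in
  one class, so the union in the definition of the product is that class.\<close>

definition presented_monoid :: "'a set \<Rightarrow> ('a list \<times> 'a list) set \<Rightarrow> 'a list set monoid" where
  "presented_monoid A R = \<lparr>carrier = lists A // gen_cong A R,
     monoid.mult = (\<lambda>C D. \<Union>u\<in>C. \<Union>v\<in>D. gen_cong A R `` {u @ v}),
     one = gen_cong A R `` {[]}\<rparr>"

text \<open>The generators are elements of \<open>M\<close> indexed by \<open>A\<close> through \<open>\<phi>\<close>.\<close>

definition has_presentation ::
  "('b, 'm) monoid_scheme \<Rightarrow> ('a \<Rightarrow> 'b) \<Rightarrow> 'a set \<Rightarrow> ('a list \<times> 'a list) set \<Rightarrow> bool" where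
  "has_presentation M \<phi> A R \<longleftrightarrow>
     (\<exists>h \<in> iso (presented_monoid A R) M. \<forall>x\<in>A. h (gen_cong A R `` {[x]}) = \<phi> x)"

lemma equiv_gen_cong:
  assumes "R \<subseteq> lists A \<times> lists A"
  shows "equiv (lists A) (gen_cong A R)"
proof (rule equivI)
  show "gen_cong A R \<subseteq> lists A \<times> lists A"
  proof (rule subrelI)
    fix u v assume "(u, v) \<in> gen_cong A R"
    then show "(u, v) \<in> lists A \<times> lists A"
      by induction (use assms in auto)
  qed
  show "refl_on (lists A) (gen_cong A R)"
    by (auto simp: refl_on_def intro: gen_cong.refl)
  show "sym (gen_cong A R)"
    by (auto intro: symI gen_cong.sym)
  show "trans (gen_cong A R)"
    by (auto intro: transI gen_cong.trans)
qed

lemma presented_monoid_mult: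
  assumes R: "R \<subseteq> lists A \<times> lists A" and "u \<in> lists A" "v \<in> lists A"
  shows "gen_cong A R `` {u} \<otimes>\<^bsub>presented_monoid A R\<^esub> gen_cong A R `` {v} = gen_cong A R `` {u @ v}"
proof -
  note eq = equiv_gen_cong[OF R]
  have "gen_cong A R `` {u' @ v'} = gen_cong A R `` {u @ v}"
    if "u' \<in> gen_cong A R `` {u}" "v' \<in> gen_cong A R `` {v}" for u' v'
    using that by (intro equiv_class_eq[OF eq]) (auto intro: gen_cong.intros)
  then have "gen_cong A R `` {u} \<otimes>\<^bsub>presented_monoid A R\<^esub> gen_cong A R `` {v}
      = (\<Union>u'\<in>gen_cong A R `` {u}. \<Union>v'\<in>gen_cong A R `` {v}. gen_cong A R `` {u @ v})"
    by (simp add: presented_monoid_def)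
  also have "\<dots> = gen_cong A R `` {u @ v}"
    using gen_cong.refl[of u A R] gen_cong.refl[of v A R] assms by blast
  finally show ?thesis .
qed

lemma monoid_presented_monoid:
  assumes R: "R \<subseteq> lists A \<times> lists A"
  shows "monoid (presented_monoid A R)"
proof -
  let ?c = "\<lambda>u. gen_cong A R `` {u}" and ?M = "presented_monoid A R"
  have carr: "carrier ?M = ?c ` lists A" and one: "\<one>\<^bsub>?M\<^esub> = ?c []"
    by (auto simp: presented_monoid_def quotient_def)
  note mult = presented_monoid_mult[OF R]
  show ?thesis
  proof (rule monoidI)
    fix x y assume "x \<in> carrier ?M" "y \<in> carrier ?M"
    then obtain u v where "u \<in> lists A" "v \<in> lists A" "x = ?c u" "y = ?c v"
      unfolding carr by blast
    then show "x \<otimes>\<^bsub>?M\<^esub> y \<in> carrier ?M"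
      by (simp add: mult carr)
  next
    show "\<one>\<^bsub>?M\<^esub> \<in> carrier ?M"
      unfolding carr one by blast
  next
    fix x y z assume "x \<in> carrier ?M" "y \<in> carrier ?M" "z \<in> carrier ?M"
    then obtain u v w where "u \<in> lists A" "v \<in> lists A" "w \<in> lists A"
      "x = ?c u" "y = ?c v" "z = ?c w"
      unfolding carr by blast
    then show "x \<otimes>\<^bsub>?M\<^esub> y \<otimes>\<^bsub>?M\<^esub> z = x \<otimes>\<^bsub>?M\<^esub> (y \<otimes>\<^bsub>?M\<^esub> z)"
      by (simp add: mult)
  next
    fix x assume "x \<in> carrier ?M"
    then obtain u where "u \<in> lists A" "x = ?c u"
      unfolding carr by blast
    then show "\<one>\<^bsub>?M\<^esub> \<otimes>\<^bsub>?M\<^esub> x = x" "x \<otimes>\<^bsub>?M\<^esub> \<one>\<^bsub>?M\<^esub> = x"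
      by (simp_all add: one mult)
  qed
qed

definition plactic_rels :: "'a::linorder set \<Rightarrow> ('a list \<times> 'a list) set" where
  "plactic_rels A =
     {([b, a, c], [b, c, a]) |a b c. a \<in> A \<and> b \<in> A \<and> c \<in> A \<and> a < b \<and> b < c} \<union>
     {([a, c, b], [c, a, b]) |a b c. a \<in> A \<and> b \<in> A \<and> c \<in> A \<and> a < b \<and> b < c} \<union>
     {([b, a, a], [a, b, a]) |a b. a \<in> A \<and> b \<in> A \<and> a < b} \<union>
     {([b, b, a], [b, a, b]) |a b. a \<in> A \<and> b \<in> A \<and> a < b}"

definition idempotent_rels :: "'a set \<Rightarrow> ('a list \<times> 'a list) set" where
  "idempotent_rels A = {([x, x], [x]) |x. x \<in> A}"

end

(* Normal forms are N-tableaux: chains of rows R1, R2, ... in which each row lies in the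
   previous one minus its minimum, read as the word ... w(R2) w(R1) with w(R) increasing.
   Appending a letter x to w(R1) is, modulo the relations, w(R1) x = y w(R1 + x), where y is the
   least letter of R1 above x; y is then inserted in the next row, so every word has a normal form.
   Distinct normal forms act differently: a word fixes a column iff the column contains all
   its letters, which determines R1; and the columns inside R1 are sent by w(R1) onto all columns
   {min R1} + g with g inside R1 - {min R1}, on which the rest of the tableau acts through g.
   Choosing R1 first gives for N-tableaux on n letters the recursion satisfied by partitions of
   n + 1 elements, R1 being the complement of the block of a distinguished element. *)

theory Submission
  imports Defs
begin

section \<open>The action of letters and words on columns\<close>

text \<open>At most one element is lost, the least one at or above \<open>x\<close>; an element
  \<open>t > x\<close> is saved exactly when a smaller one at or above \<open>x\<close> is there to
  be bumped instead. Without \<open>Min\<close>, equalities of columns become first-order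
  facts.\<close>

lemma mem_letter_act:
  assumes "finite \<gamma>"
  shows "t \<in> letter_act x \<gamma> \<longleftrightarrow> t = x \<or> t \<in> \<gamma> \<and> (t < x \<or> (\<exists>y\<in>\<gamma>. x \<le> y \<and> y < t))"
proof (cases "\<forall>y\<in>\<gamma>. y < x")
  case True
  then show ?thesis by (auto simp: letter_act_def)
next
  case False
  define m where "m = Min {y\<in>\<gamma>. x \<le> y}"
  have ne: "{y\<in>\<gamma>. x \<le> y} \<noteq> {}" and fin: "finite {y\<in>\<gamma>. x \<le> y}"
    using False assms by (auto simp: not_less)
  have m: "m \<in> \<gamma>" "x \<le> m" using Min_in[OF fin ne] by (auto simp: m_def)
  have le: "m \<le> y" if "y \<in> \<gamma>" "x \<le> y" for y
    using that fin by (auto simp: m_def)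
  have eq: "letter_act x \<gamma> = \<gamma> - {m} \<union> {x}"
    using False unfolding letter_act_def m_def by (simp only: if_False)
  have "t \<noteq> m \<longleftrightarrow> t < x \<or> (\<exists>y\<in>\<gamma>. x \<le> y \<and> y < t)" if "t \<in> \<gamma>"
    using m le[OF that] le by (meson leD leI order.not_eq_order_implies_strict order.strict_trans1)
  then show ?thesis unfolding eq by auto
qed

lemma finite_letter_act [simp]: "finite \<gamma> \<Longrightarrow> finite (letter_act x \<gamma>)"
  by (simp add: letter_act_def)

lemma finite_word_act [simp]: "finite \<gamma> \<Longrightarrow> finite (word_act w \<gamma>)"
  by (induction w) auto

lemma letter_act_id:
  assumes "finite \<gamma>" "x \<in> \<gamma>"
  shows "letter_act x \<gamma> = \<gamma>"
  using assms by (auto simp: set_eq_iff mem_letter_act)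

lemma letter_act_insert_less:
  assumes "finite \<gamma>" "s < x"
  shows "letter_act x (insert s \<gamma>) = insert s (letter_act x \<gamma>)"
  using assms by (auto simp: set_eq_iff mem_letter_act)

text \<open>A letter neither bumps nor consults the elements below it. Later this strips the minimum
  of a row from the columns seen by the rows after it.\<close>

lemma word_act_insert_less:
  assumes "finite \<gamma>" "\<forall>x\<in>set w. s < x"
  shows "word_act w (insert s \<gamma>) = insert s (word_act w \<gamma>)"
  using assms by (induction w) (auto simp: letter_act_insert_less)

text \<open>The element \<open>y\<close> keeps the letters apart: \<open>a\<close> bumps something
  at most \<open>y\<close>, hence below \<open>c\<close>, while \<open>c\<close> can only bump at or
  above \<open>c\<close>.\<close>

lemma letter_act_commute:
  assumes "finite \<gamma>" "y \<in> \<gamma>" "a \<le> y" "y < c"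
  shows "letter_act a (letter_act c \<gamma>) = letter_act c (letter_act a \<gamma>)"
proof -
  have c: "(\<exists>z\<in>letter_act c \<gamma>. a \<le> z \<and> z < t) \<longleftrightarrow> (\<exists>z\<in>\<gamma>. a \<le> z \<and> z < t)" for t
  proof
    assume "\<exists>z\<in>letter_act c \<gamma>. a \<le> z \<and> z < t"
    then obtain z where z: "z = c \<or> z \<in> \<gamma>" "a \<le> z" "z < t"
      using mem_letter_act[OF assms(1)] by blast
    then show "\<exists>z\<in>\<gamma>. a \<le> z \<and> z < t"
      using assms by (metis order.strict_trans)
  next
    assume "\<exists>z\<in>\<gamma>. a \<le> z \<and> z < t"
    then obtain z where z: "z \<in> \<gamma>" "a \<le> z" "z < t" by blast
    show "\<exists>z\<in>letter_act c \<gamma>. a \<le> z \<and> z < t"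
    proof (cases "z < c")
      case True
      then show ?thesis using assms z by (intro bexI[of _ z]) (auto simp: mem_letter_act)
    next
      case False
      then show ?thesis using assms z by (intro bexI[of _ y]) (auto simp: mem_letter_act)
    qed
  qed
  have a: "(\<exists>z\<in>letter_act a \<gamma>. c \<le> z \<and> z < t) \<longleftrightarrow> (\<exists>z\<in>\<gamma>. c \<le> z \<and> z < t)" for t
  proof
    assume "\<exists>z\<in>letter_act a \<gamma>. c \<le> z \<and> z < t"
    then show "\<exists>z\<in>\<gamma>. c \<le> z \<and> z < t"
      using assms by (force simp: mem_letter_act)
  next
    assume "\<exists>z\<in>\<gamma>. c \<le> z \<and> z < t"
    then obtain z where z: "z \<in> \<gamma>" "c \<le> z" "z < t" by blast
    then have "z \<in> letter_act a \<gamma>" using assms by (auto simp: mem_letter_act)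
    with z show "\<exists>z\<in>letter_act a \<gamma>. c \<le> z \<and> z < t" by blast
  qed
  have "a < c" using assms by simp
  then show ?thesis
    using assms by (auto simp: set_eq_iff mem_letter_act a c)
qed

text \<open>Nothing lies from \<open>a\<close> up to just below \<open>c\<close>, so
  \<open>c\<close> bumps the very element, if any, that \<open>a\<close> would bump, and then
  \<open>a\<close> bumps \<open>c\<close>.\<close>

lemma letter_act_absorb:
  assumes "finite \<gamma>" "a \<le> c" "\<forall>y\<in>\<gamma>. y < a \<or> c \<le> y"
  shows "letter_act a (letter_act c \<gamma>) = letter_act a \<gamma>"
proof -
  have c: "(\<exists>z\<in>letter_act c \<gamma>. a \<le> z \<and> z < t) \<longleftrightarrow> c < t" for t
  proof
    assume "\<exists>z\<in>letter_act c \<gamma>. a \<le> z \<and> z < t"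
    then show "c < t"
      using assms by (force simp: mem_letter_act)
  next
    assume "c < t"
    with assms show "\<exists>z\<in>letter_act c \<gamma>. a \<le> z \<and> z < t"
      by (intro bexI[of _ c]) (auto simp: mem_letter_act)
  qed
  have a: "a \<le> y \<longleftrightarrow> c \<le> y" if "y \<in> \<gamma>" for y
    using assms that by force
  have "t \<in> letter_act a (letter_act c \<gamma>) \<longleftrightarrow> t \<in> letter_act a \<gamma>" for t
  proof (cases "t \<in> \<gamma> \<and> \<not> t < a")
    case True
    then show ?thesis
      using assms a by (auto simp: mem_letter_act c)
  next
    case False
    then show ?thesis
      using assms by (auto simp: mem_letter_act c)
  qed
  then show ?thesis by blast
qed

text \<open>The cases with \<open>b = c\<close> here, and \<open>a = b\<close> in \<open>act_acb\<close>, are the relations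
  \<open>bba = bab\<close> and \<open>baa = aba\<close>.\<close>

lemma act_bac:
  assumes "finite \<gamma>" "a < b" "b \<le> c"
  shows "word_act [b, a, c] \<gamma> = word_act [b, c, a] \<gamma>"
proof (cases "\<exists>y\<in>\<gamma>. a \<le> y \<and> y < c")
  case True
  then show ?thesis using letter_act_commute[OF assms(1)] by (metis word_act.simps)
next
  case False
  then have no: "\<forall>y\<in>\<gamma>. y < a \<or> c \<le> y" by force
  \<comment> \<open>Now \<open>c\<close> is absorbed on both sides, by \<open>a\<close> in one word
    and by \<open>b\<close> in the other; what remains is \<open>b\<close> after
    \<open>a\<close>.\<close>
  then have "\<forall>y\<in>letter_act a \<gamma>. y < b \<or> c \<le> y"
    using assms by (metis mem_letter_act order.strict_trans)
  with no show ?thesis using assms letter_act_absorb[of \<gamma> a c]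
    letter_act_absorb[of "letter_act a \<gamma>" b c] by auto
qed

lemma act_acb:
  assumes "finite \<gamma>" "a \<le> b" "b < c"
  shows "word_act [a, c, b] \<gamma> = word_act [c, a, b] \<gamma>"
  \<comment> \<open>Once \<open>b\<close> has acted, it is itself the element between
    \<open>a\<close> and \<open>c\<close> that \<open>letter_act_commute\<close> asks for.\<close>
  using assms letter_act_commute[of "letter_act b \<gamma>" b a c] by (simp add: mem_letter_act)

section \<open>Validity of the relations for the action\<close>

abbreviation styl_rels :: "'a::linorder set \<Rightarrow> ('a list \<times> 'a list) set" where
  "styl_rels A \<equiv> plactic_rels A \<union> idempotent_rels A"

abbreviation styl_cong :: "'a::linorder set \<Rightarrow> ('a list \<times> 'a list) set" where
  "styl_cong A \<equiv> gen_cong A (styl_rels A)"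

lemma styl_rels_subset: "styl_rels A \<subseteq> lists A \<times> lists A"
  by (auto simp: plactic_rels_def idempotent_rels_def)

lemma word_act_styl_rels:
  assumes "(u, v) \<in> styl_rels A" "finite \<gamma>"
  shows "word_act u \<gamma> = word_act v \<gamma>"
proof -
  consider (bac) a b c where "a < b" "b < c" "u = [b, a, c]" "v = [b, c, a]"
    | (acb) a b c where "a < b" "b < c" "u = [a, c, b]" "v = [c, a, b]"
    | (baa) a b where "a < b" "u = [b, a, a]" "v = [a, b, a]"
    | (bba) a b where "a < b" "u = [b, b, a]" "v = [b, a, b]"
    | (xx) x where "u = [x, x]" "v = [x]"
    using assms(1) unfolding plactic_rels_def idempotent_rels_def by blast
  then show ?thesis
  proof cases
    case xx
    have "x \<in> letter_act x \<gamma>" using assms(2) by (simp add: mem_letter_act)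
    then show ?thesis using xx assms(2) by (simp add: letter_act_id)
  next
    case bac
    then show ?thesis using act_bac[OF assms(2), of a b c] by simp
  next
    case acb
    then show ?thesis using act_acb[OF assms(2), of a b c] by simp
  next
    case baa
    then show ?thesis using act_acb[OF assms(2), of a a b] by simp
  next
    case bba
    then show ?thesis using act_bac[OF assms(2), of a b b] by simp
  qed
qed

lemma word_act_styl_cong:
  assumes "(u, v) \<in> styl_cong A" "finite \<gamma>"
  shows "word_act u \<gamma> = word_act v \<gamma>"
  using assms
proof (induction arbitrary: \<gamma>)
  case (base u v)
  then show ?case using word_act_styl_rels by blast
next
  case (mult u v u' v')
  then show ?case by (simp add: word_act_append)
qed auto

section \<open>Row insertion modulo the relations\<close>

lemmas [trans] = gen_cong.trans

text \<open>Weak inequalities merge each plactic relation with its degenerate case of a repeated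
  letter, so the row computations cite one rule for both.\<close>

lemma styl_congI:
  assumes "a \<in> A" "b \<in> A"
  shows "a < b \<Longrightarrow> b \<le> c \<Longrightarrow> c \<in> A \<Longrightarrow> ([b, a, c], [b, c, a]) \<in> styl_cong A"
    and "a \<le> b \<Longrightarrow> b < c \<Longrightarrow> c \<in> A \<Longrightarrow> ([a, c, b], [c, a, b]) \<in> styl_cong A"
    and "([a, a], [a]) \<in> styl_cong A"
proof -
  show "([a, a], [a]) \<in> styl_cong A"
    using assms by (auto simp: idempotent_rels_def intro!: gen_cong.base)
  show "([b, a, c], [b, c, a]) \<in> styl_cong A" if "a < b" "b \<le> c" "c \<in> A"
  proof (cases "b = c")
    case True
    then have "([b, c, a], [b, a, c]) \<in> styl_rels A"
      using assms that by (auto simp: plactic_rels_def)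
    then show ?thesis by (intro gen_cong.sym[OF gen_cong.base])
  next
    case False
    then show ?thesis
      using assms that by (intro gen_cong.base) (auto simp: plactic_rels_def)
  qed
  show "([a, c, b], [c, a, b]) \<in> styl_cong A" if "a \<le> b" "b < c" "c \<in> A"
  proof (cases "a = b")
    case True
    then have "([c, a, b], [a, c, b]) \<in> styl_rels A"
      using assms that by (auto simp: plactic_rels_def)
    then show ?thesis by (intro gen_cong.sym[OF gen_cong.base])
  next
    case False
    then show ?thesis
      using assms that by (intro gen_cong.base) (auto simp: plactic_rels_def)
  qed
qed

lemma styl_cong_app:
  assumes "(u, v) \<in> styl_cong A" "p \<in> lists A" "q \<in> lists A"
  shows "(p @ u @ q, p @ v @ q) \<in> styl_cong A"
  using assms by (intro gen_cong.mult gen_cong.refl)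

declare sorted_list_of_set_insert_remove [simp del]

lemma sorted_list_of_set_insert_Min:
  assumes "finite R" "\<forall>r\<in>R. z < r"
  shows "sorted_list_of_set (insert z R) = z # sorted_list_of_set R"
proof (rule strict_sorted_equal)
  show "sorted_wrt (<) (sorted_list_of_set (insert z R))"
    "sorted_wrt (<) (z # sorted_list_of_set R)" using assms by auto
  show "set (sorted_list_of_set (insert z R)) = set (z # sorted_list_of_set R)" using assms by auto
qed

text \<open>An appended \<open>x\<close> either extends the increasing word or repeats its last
  letter; idempotence merges the repetition.\<close>

lemma row_append:
  assumes "finite R" "R \<subseteq> A" "x \<in> A" "\<forall>r\<in>R. r \<le> x"
  shows "(sorted_list_of_set R @ [x], sorted_list_of_set (insert x R)) \<in> styl_cong A"
  using assms
proof (induction R rule: finite_linorder_min_induct)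
  case empty
  then show ?case by (auto intro: gen_cong.refl)
next
  case (insert z R)
  note Zs = sorted_list_of_set_insert_Min
  show ?case
  proof (cases "z = x")
    case True
    then have "R = {}" using insert by fastforce
    then show ?thesis using True insert styl_congI(3)[of x A x] by simp
  next
    case False
    then have "z < x" using insert by auto
    then have "sorted_list_of_set (insert z (insert x R)) = z # sorted_list_of_set (insert x R)"
      using insert by (intro Zs) auto
    then show ?thesis
      using insert styl_cong_app[of "sorted_list_of_set R @ [x]" _ A "[z]" "[]"]
      by (simp add: Zs insert_commute)
  qed
qed

text \<open>The new letter travels left: for \<open>x < y < z\<close> the relation bca = bac turns
  \<open>y z x\<close> into \<open>y x z\<close>, with the left neighbour \<open>y\<close> as
  witness. For the rest of the row \<open>z\<close> is the witness, hence the general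
  \<open>y\<close>.\<close>

lemma bump_past:
  assumes "finite R" "R \<subseteq> A" "x \<in> A" "y \<in> A" "x < y" "\<forall>r\<in>R. y < r"
  shows "(y # sorted_list_of_set R @ [x], y # x # sorted_list_of_set R) \<in> styl_cong A"
  using assms
proof (induction R arbitrary: y rule: finite_linorder_min_induct)
  case empty
  then show ?case by (auto intro: gen_cong.refl)
next
  case (insert z R)
  let ?v = "sorted_list_of_set R"
  have v: "?v \<in> lists A" using insert by auto
  have 1: "(z # ?v @ [x], z # x # ?v) \<in> styl_cong A"
    using insert by (intro insert.IH) auto
  have 2: "([y, z, x], [y, x, z]) \<in> styl_cong A"
    using insert by (intro gen_cong.sym[OF styl_congI(1)]) auto
  have "(y # z # ?v @ [x], y # z # x # ?v) \<in> styl_cong A"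
    using styl_cong_app[OF 1, of "[y]" "[]"] insert by auto
  also have "(y # z # x # ?v, y # x # z # ?v) \<in> styl_cong A"
    using styl_cong_app[OF 2, of "[]" "?v"] v by auto
  finally show ?case
    using insert by (simp add: sorted_list_of_set_insert_Min)
qed

text \<open>Schensted insertion into a row, with one difference: the bumped \<open>y\<close> also
  stays behind, because idempotence supplies a second copy. The induction removes the least letter
  \<open>z\<close> of the row, and its position relative to \<open>x\<close> selects the relation
  used.\<close>

lemma row_insert:
  assumes "finite R" "R \<subseteq> A" "x \<in> A" "y \<in> R" "x < y" "\<forall>r\<in>R. r \<le> x \<or> y \<le> r"
  shows "(sorted_list_of_set R @ [x], y # sorted_list_of_set (insert x R)) \<in> styl_cong A"
  using assms
proof (induction R rule: finite_linorder_min_induct)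
  case empty
  then show ?case by simp
next
  case (insert z R)
  note Zs = sorted_list_of_set_insert_Min
  let ?v = "sorted_list_of_set R" and ?w = "sorted_list_of_set (insert x R)"
  have v: "?v \<in> lists A" "?w \<in> lists A" using insert by auto
  have yA: "y \<in> A" and zA: "z \<in> A" using insert by auto
  consider "x < z" | "z = x" | "z < x" by fastforce
  then show ?case
  proof cases
    case 1
    then have z: "z = y" using insert by force
    have 2: "([y], [y, y]) \<in> styl_cong A" "([y, y, x], [y, x, y]) \<in> styl_cong A"
      using yA insert by (auto intro: styl_congI gen_cong.sym)
    \<comment> \<open>Here \<open>y\<close> heads the row. Once \<open>x\<close> stands next to it,
      \<open>y\<close> is doubled, and bba = bab leaves one \<open>y\<close> in front of
      \<open>x\<close> and the other behind it.\<close>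
    have "(y # ?v @ [x], y # x # ?v) \<in> styl_cong A"
      using insert z by (intro bump_past) auto
    also have "(y # x # ?v, y # y # x # ?v) \<in> styl_cong A"
      using styl_cong_app[OF 2(1), of "[]" "x # ?v"] v insert by simp
    also have "(y # y # x # ?v, y # x # y # ?v) \<in> styl_cong A"
      using styl_cong_app[OF 2(2), of "[]" "?v"] v by simp
    also have "x # y # ?v = sorted_list_of_set (insert x (insert z R))"
      using insert 1 z by (subst Zs) (auto simp: Zs)
    finally show ?thesis using insert z by (simp add: Zs)
  next
    case 2
    have IH: "(?v @ [x], y # x # ?v) \<in> styl_cong A"
      using insert 2 by (auto simp: Zs)
    \<comment> \<open>\<open>y\<close> is bumped although the row already has \<open>x\<close>: aba
      = baa carries \<open>y\<close> over the first \<open>x\<close>, and the two copies of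
      \<open>x\<close> merge.\<close>
    have 3: "([x, y, x], [y, x, x]) \<in> styl_cong A" "([x, x], [x]) \<in> styl_cong A"
      using yA insert by (auto intro: styl_congI)
    have "(x # ?v @ [x], x # y # x # ?v) \<in> styl_cong A"
      using styl_cong_app[OF IH, of "[x]" "[]"] insert by simp
    also have "(x # y # x # ?v, y # x # x # ?v) \<in> styl_cong A"
      using styl_cong_app[OF 3(1), of "[]" "?v"] v by simp
    also have "(y # x # x # ?v, y # x # ?v) \<in> styl_cong A"
      using styl_cong_app[OF 3(2), of "[y]" "?v"] v yA by simp
    finally show ?thesis using insert 2 by (simp add: Zs)
  next
    case 3
    have IH: "(?v @ [x], y # ?w) \<in> styl_cong A"
      using insert 3 by auto
    \<comment> \<open>\<open>p\<close> is the first letter of \<open>?w\<close>. As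
      \<open>z < p \<le> x < y\<close>, it serves as the b in acb = cab, which carries
      \<open>y\<close> over \<open>z\<close>.\<close>
    obtain p S where p: "insert x R = insert p S" "finite S" "\<forall>s\<in>S. p < s" "z < p" "p \<le> x"
    proof
      let ?p = "Min (insert x R)"
      have fin: "finite (insert x R)" using insert by auto
      have mem: "?p \<in> insert x R" by (rule Min_in[OF fin]) simp
      then show "insert x R = insert ?p (insert x R - {?p})" by blast
      show "finite (insert x R - {?p})" using fin by blast
      show "\<forall>s\<in>insert x R - {?p}. ?p < s" using Min_le[OF fin] by (metis DiffE insertI1 order.not_eq_order_implies_strict)
      show "?p \<le> x" using fin by simp
      show "z < ?p" using mem insert 3 by auto
    qed
    have "insert p S \<subseteq> A" unfolding p(1)[symmetric] using insert.prems by auto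
    then have pA: "p \<in> A" by blast
    have w: "?w = p # sorted_list_of_set S" using p by (simp add: Zs)
    have 4: "([z, y, p], [y, z, p]) \<in> styl_cong A"
      using p pA yA zA insert.prems by (intro styl_congI(2)) auto
    have "(z # ?v @ [x], z # y # ?w) \<in> styl_cong A"
      using styl_cong_app[OF IH, of "[z]" "[]"] zA by simp
    also have "(z # y # ?w, y # z # ?w) \<in> styl_cong A"
      using styl_cong_app[OF 4, of "[]" "sorted_list_of_set S"] v unfolding w by simp
    also have "z # ?w = sorted_list_of_set (insert x (insert z R))"
      using 3 insert by (subst insert_commute, subst Zs) auto
    finally show ?thesis using insert by (simp add: Zs)
  qed
qed

section \<open>N-tableaux as normal forms\<close>

text \<open>The set parameter passes the bound for the next row down the list. Barring empty rows
  keeps \<open>[]\<close> and \<open>[{}]\<close> from sharing a word.\<close>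

fun n_tableau :: "'a::linorder set \<Rightarrow> 'a set list \<Rightarrow> bool" where
  "n_tableau A [] \<longleftrightarrow> True"
| "n_tableau A (R # T) \<longleftrightarrow> R \<noteq> {} \<and> R \<subseteq> A \<and> n_tableau (R - {Min R}) T"

primrec tab_word :: "'a::linorder set list \<Rightarrow> 'a list" where
  "tab_word [] = []"
| "tab_word (R # T) = tab_word T @ sorted_list_of_set R"

lemma n_tableau_mono: "n_tableau A T \<Longrightarrow> A \<subseteq> B \<Longrightarrow> n_tableau B T"
  by (cases T) auto

text \<open>Later rows lie in the first one, so the support of the word reveals the first
  row.\<close>

lemma set_tab_word:
  assumes "n_tableau A T" "finite A"
  shows "set (tab_word T) = (case T of [] \<Rightarrow> {} | R # _ \<Rightarrow> R)"
  using assms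
proof (induction A T rule: n_tableau.induct)
  case (2 A R T)
  then have "finite R" by (auto intro: finite_subset)
  with 2 show ?case by (auto split: list.splits)
qed simp

lemma tab_word_in_lists:
  assumes "n_tableau A T" "finite A"
  shows "tab_word T \<in> lists A"
  using set_tab_word[OF assms] assms by (cases T) auto

lemma styl_cong_mono:
  assumes "(u, v) \<in> styl_cong B" "B \<subseteq> A"
  shows "(u, v) \<in> styl_cong A"
  using assms
proof induction
  case (base u v)
  then have "(u, v) \<in> styl_rels A" by (fastforce simp: plactic_rels_def idempotent_rels_def)
  then show ?case by (rule gen_cong.base)
qed (auto intro: gen_cong.intros)

text \<open>The alphabet is general because a bumped letter is inserted into a tail that is an
  N-tableau over the first row without its minimum.\<close>

lemma tableau_insert:
  assumes "finite A" "n_tableau A T" "x \<in> A"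
  shows "\<exists>T'. n_tableau A T' \<and> (tab_word T @ [x], tab_word T') \<in> styl_cong A"
  using assms
proof (induction T arbitrary: A x)
  case Nil
  then show ?case by (intro exI[of _ "[{x}]"]) (auto intro: gen_cong.refl)
next
  case (Cons R T)
  define R' where "R' = insert x R"
  have R: "finite R" "R \<noteq> {}" "R \<subseteq> A" "n_tableau (R - {Min R}) T"
    using Cons.prems by (auto intro: finite_subset)
  then have R': "finite R'" "R' \<noteq> {}" "R' \<subseteq> A" using Cons.prems by (auto simp: R'_def)
  have "Min R' \<le> Min R" "Min R' \<le> x" using R R' by (auto simp: R'_def)
  \<comment> \<open>The row can only grow and its minimum can only drop, so \<open>T\<close> still
    fits below the new row.\<close>
  have "R - {Min R} \<subseteq> R' - {Min R'}"
  proof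
    fix r assume r: "r \<in> R - {Min R}"
    then have "Min R \<noteq> r" "Min R \<le> r" using R by auto
    then have "Min R < r" by auto
    then show "r \<in> R' - {Min R'}" using r \<open>Min R' \<le> Min R\<close> by (auto simp: R'_def)
  qed
  then have T: "n_tableau (R' - {Min R'}) T" using R n_tableau_mono by blast
  have wT: "tab_word T \<in> lists A"
    using tab_word_in_lists[OF R(4)] R by auto
  show ?case
  proof (cases "\<forall>r\<in>R. r \<le> x")
    case True
    have "(sorted_list_of_set R @ [x], sorted_list_of_set R') \<in> styl_cong A"
      unfolding R'_def using R Cons.prems True by (intro row_append) auto
    then have "(tab_word T @ sorted_list_of_set R @ [x], tab_word T @ sorted_list_of_set R') \<in> styl_cong A"
      using styl_cong_app[of _ _ A "tab_word T" "[]"] wT by auto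
    then show ?thesis using R' T by (intro exI[of _ "R' # T"]) auto
  next
    case False
    define y where "y = Min {r\<in>R. x < r}"
    have fin: "finite {r\<in>R. x < r}" and ne: "{r\<in>R. x < r} \<noteq> {}" using R False by (auto simp: not_le)
    have y: "y \<in> R" "x < y" using Min_in[OF fin ne] by (auto simp: y_def)
    have "r \<le> x \<or> y \<le> r" if "r \<in> R" for r using that fin by (cases "x < r") (auto simp: y_def not_less)
    then have row: "(sorted_list_of_set R @ [x], y # sorted_list_of_set R') \<in> styl_cong A"
      unfolding R'_def using R Cons.prems y by (intro row_insert) auto
    \<comment> \<open>The bumped letter exceeds \<open>x\<close>, so it is not the new minimum and
      may enter the rows below.\<close>
    have "y \<in> R' - {Min R'}" using y \<open>Min R' \<le> x\<close> by (auto simp: R'_def)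
    then obtain T' where T': "n_tableau (R' - {Min R'}) T'"
      "(tab_word T @ [y], tab_word T') \<in> styl_cong (R' - {Min R'})"
      using Cons.IH[OF _ T] R' by auto
    have "R' - {Min R'} \<subseteq> A" using R' by auto
    then have T'': "(tab_word T @ [y], tab_word T') \<in> styl_cong A"
      using T' styl_cong_mono by blast
    have wR': "sorted_list_of_set R' \<in> lists A"
      unfolding in_lists_conv_set using R' by auto
    have "(tab_word T @ sorted_list_of_set R @ [x], tab_word T @ y # sorted_list_of_set R') \<in> styl_cong A"
      using styl_cong_app[OF row, of "tab_word T" "[]"] wT by simp
    also have "(tab_word T @ y # sorted_list_of_set R', tab_word T' @ sorted_list_of_set R') \<in> styl_cong A"
      using styl_cong_app[OF T'', of "[]" "sorted_list_of_set R'"] wR' by simp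
    finally show ?thesis using R' T' by (intro exI[of _ "R' # T'"]) auto
  qed
qed

lemma ex_tableau:
  assumes "finite A" "w \<in> lists A"
  shows "\<exists>T. n_tableau A T \<and> (w, tab_word T) \<in> styl_cong A"
  using assms(2)
proof (induction w rule: rev_induct)
  case Nil
  then show ?case by (intro exI[of _ "[]"]) (auto intro: gen_cong.refl)
next
  case (snoc x w)
  then obtain T where T: "n_tableau A T" "(w, tab_word T) \<in> styl_cong A" by auto
  obtain T' where T': "n_tableau A T'" "(tab_word T @ [x], tab_word T') \<in> styl_cong A"
    using tableau_insert[OF assms(1) T(1)] snoc.prems by auto
  have "(w @ [x], tab_word T @ [x]) \<in> styl_cong A"
    using styl_cong_app[OF T(2), of "[]" "[x]"] snoc.prems by simp
  then show ?case using T' gen_cong.trans by blast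
qed

section \<open>Faithfulness of the normal forms\<close>

text \<open>Counting the elements of a column below a threshold \<open>t\<close> shows that letters move a column
  in one direction only, so a word fixes a column only if each of its letters does.\<close>

lemma card_atMost_letter_act:
  assumes "finite \<gamma>"
  shows "card (\<gamma> \<inter> {..t}) \<le> card (letter_act x \<gamma> \<inter> {..t})"
proof (cases "\<gamma> \<inter> {..t} \<subseteq> letter_act x \<gamma>")
  case True
  then show ?thesis using assms by (intro card_mono) auto
next
  case False
  then obtain y where y: "y \<in> \<gamma>" "y \<le> t" "y \<notin> letter_act x \<gamma>" by auto
  then have "x < y" "\<forall>z\<in>\<gamma>. x \<le> z \<longrightarrow> y \<le> z"
    using assms by (auto simp: mem_letter_act not_less)
  then have "insert x (\<gamma> \<inter> {..t} - {y}) \<subseteq> letter_act x \<gamma> \<inter> {..t}" "x \<notin> \<gamma>"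
    using y assms by (auto simp: mem_letter_act not_less intro: order.antisym)
  then have "card (insert x (\<gamma> \<inter> {..t} - {y})) \<le> card (letter_act x \<gamma> \<inter> {..t})"
    using assms by (intro card_mono) auto
  moreover have "card (insert x (\<gamma> \<inter> {..t} - {y})) = card (\<gamma> \<inter> {..t})"
    using y \<open>x \<notin> \<gamma>\<close> assms card_Suc_Diff1[of "\<gamma> \<inter> {..t}" y] by simp
  ultimately show ?thesis by simp
qed

lemma card_atMost_word_act:
  assumes "finite \<gamma>"
  shows "card (\<gamma> \<inter> {..t}) \<le> card (word_act w \<gamma> \<inter> {..t})"
  using assms by (induction w) (auto intro: order_trans[OF _ card_atMost_letter_act])

text \<open>At the threshold \<open>x\<close> itself nothing is lost, as any bumped element lies
  above it, and \<open>x\<close> is gained.\<close>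

lemma card_atMost_letter_act_less:
  assumes "finite \<gamma>" "x \<notin> \<gamma>"
  shows "card (\<gamma> \<inter> {..x}) < card (letter_act x \<gamma> \<inter> {..x})"
proof -
  have "insert x (\<gamma> \<inter> {..x}) \<subseteq> letter_act x \<gamma> \<inter> {..x}"
    using assms by (auto simp: mem_letter_act)
  then have "card (insert x (\<gamma> \<inter> {..x})) \<le> card (letter_act x \<gamma> \<inter> {..x})"
    using assms by (intro card_mono) auto
  then show ?thesis using assms by simp
qed

lemma word_act_fixed_iff:
  assumes "finite \<gamma>"
  shows "word_act w \<gamma> = \<gamma> \<longleftrightarrow> set w \<subseteq> \<gamma>"
proof (induction w)
  case (Cons x w)
  show ?case
  proof
    assume eq: "word_act (x # w) \<gamma> = \<gamma>"
    let ?\<delta> = "word_act w \<gamma>"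
    have fin: "finite ?\<delta>" using assms by simp
    \<comment> \<open>Otherwise the count up to \<open>x\<close> would grow strictly at this letter;
      the letters of \<open>w\<close> cannot have lowered it, so the column could not return to
      \<open>\<gamma>\<close>.\<close>
    have "x \<in> ?\<delta>"
      using card_atMost_letter_act_less[OF fin, of x] card_atMost_word_act[OF assms, of x w] eq by auto
    then show "set (x # w) \<subseteq> \<gamma>" using eq Cons letter_act_id[OF fin] by auto
  qed (use Cons assms letter_act_id in auto)
qed simp

text \<open>The letters after \<open>s\<close> act first and, by induction, can leave their minimum
  \<open>z\<close> together with any larger part. If \<open>z\<close> is wanted, \<open>s\<close> is
  put into the column beforehand and its own action then changes nothing; otherwise \<open>s\<close>
  comes last and bumps \<open>z\<close>.\<close>

lemma row_act_onto:
  assumes "finite R" "\<forall>r\<in>R. s < r" "\<delta> \<subseteq> R"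
  shows "\<exists>\<gamma>\<subseteq>insert s R. word_act (sorted_list_of_set (insert s R)) \<gamma> = insert s \<delta>"
  using assms
proof (induction R arbitrary: s \<delta> rule: finite_linorder_min_induct)
  case empty
  then show ?case by (intro exI[of _ "{}"]) (auto simp: letter_act_def)
next
  case (insert z R)
  note fin = insert.hyps(1) and zR = insert.hyps(2) and sR = insert.prems(1) and dR = insert.prems(2)
  let ?w = "sorted_list_of_set (insert z R)"
  have fd: "finite \<delta>" using fin dR finite_subset by blast
  have w: "sorted_list_of_set (insert s (insert z R)) = s # ?w"
    using fin sR by (intro sorted_list_of_set_insert_Min) auto
  have "\<delta> - {z} \<subseteq> R" using dR by blast
  from insert.IH[OF zR this] obtain \<gamma>
    where \<gamma>: "\<gamma> \<subseteq> insert z R" "word_act ?w \<gamma> = insert z (\<delta> - {z})" by blast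
  have fg: "finite \<gamma>" using \<gamma>(1) fin finite_subset by blast
  show ?case
  proof (cases "z \<in> \<delta>")
    case True
    have "\<forall>x\<in>set ?w. s < x" using fin sR by simp
    then have "word_act ?w (insert s \<gamma>) = insert s \<delta>"
      using word_act_insert_less[OF fg, of ?w s] \<gamma>(2) True by (simp add: insert_absorb)
    then have "word_act (s # ?w) (insert s \<gamma>) = insert s \<delta>"
      using fd by (simp add: letter_act_id)
    then show ?thesis using \<gamma>(1) unfolding w by (intro exI[of _ "insert s \<gamma>"]) blast
  next
    case False
    have less: "s < z" "\<forall>r\<in>\<delta>. z < r" using zR sR dR False by auto
    then have "{y \<in> insert z \<delta>. s \<le> y} = insert z \<delta>" by force
    moreover have "Min (insert z \<delta>) = z"
      using less fd by (intro Min_eqI) auto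
    ultimately have "letter_act s (insert z \<delta>) = insert s (insert z \<delta> - {z})"
      using less unfolding letter_act_def by (auto simp: not_less)
    then have "word_act (s # ?w) \<gamma> = insert s \<delta>" using \<gamma>(2) False by simp
    then show ?thesis using \<gamma>(1) unfolding w by (intro exI[of _ "\<gamma>"]) blast
  qed
qed

lemma tab_word_inject:
  assumes "finite A" "n_tableau A T" "n_tableau A T'"
    and "\<forall>\<gamma>\<in>Pow A. word_act (tab_word T) \<gamma> = word_act (tab_word T') \<gamma>"
  shows "T = T'"
  using assms
proof (induction A T arbitrary: T' rule: n_tableau.induct)
  case (1 A)
  then have "set (tab_word T') \<subseteq> {}"
    using word_act_fixed_iff[of "{}" "tab_word T'"] by (metis Pow_bottom finite.emptyI tab_word.simps(1) word_act.simps(1))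
  then show ?case using 1 set_tab_word[of A T'] by (cases T') auto
next
  case (2 A R T)
  have R: "finite R" "R \<noteq> {}" "R \<subseteq> A" "n_tableau (R - {Min R}) T"
    using 2 by (auto intro: finite_subset)
  have "set (tab_word (R # T)) \<subseteq> \<gamma> \<longleftrightarrow> set (tab_word T') \<subseteq> \<gamma>" if "\<gamma> \<subseteq> A" for \<gamma>
    using 2(5) that finite_subset[OF that 2(2)] word_act_fixed_iff by (metis PowI)
  \<comment> \<open>Both supports are columns over \<open>A\<close>; taking each of them as
    \<open>\<gamma>\<close> gives the two inclusions.\<close>
  then have "set (tab_word (R # T)) = set (tab_word T')"
    using tab_word_in_lists[OF 2(3,2)] tab_word_in_lists[OF 2(4,2)]
    by (meson in_listsD subset_antisym subset_code(1) order_refl)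
  then have "set (tab_word T') = R" using set_tab_word[OF 2(3,2)] by simp
  then obtain S where T': "T' = R # S"
    using set_tab_word[OF 2(4,2)] R by (cases T') auto
  let ?s = "Min R" and ?R = "R - {Min R}"
  have ins: "insert ?s ?R = R" and less: "\<forall>r\<in>?R. ?s < r"
    using R by (auto simp: insert_absorb order.not_eq_order_implies_strict)
  have S: "n_tableau ?R S" using 2(4) T' by simp
  \<comment> \<open>\<open>\<delta>\<close> is handed to the tails as
    \<open>insert ?s \<delta>\<close>, a column that the common row produces by
    \<open>row_act_onto\<close>. As \<open>?s\<close> is below all letters of the tails, it passes
    through unchanged and can be cancelled.\<close>
  have "word_act (tab_word T) \<delta> = word_act (tab_word S) \<delta>" if \<delta>: "\<delta> \<in> Pow ?R" for \<delta>
  proof -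
    have fd: "finite \<delta>" using \<delta> R finite_subset by blast
    obtain \<gamma> where \<gamma>: "\<gamma> \<subseteq> R" "word_act (sorted_list_of_set R) \<gamma> = insert ?s \<delta>"
      using row_act_onto[OF _ less, of \<delta>, unfolded ins] R(1) \<delta> by auto
    have "word_act (tab_word T) (insert ?s \<delta>) = word_act (tab_word S) (insert ?s \<delta>)"
      using 2(5) \<gamma> R unfolding T' by (metis Pow_iff tab_word.simps(2) subset_trans word_act_append)
    moreover have "word_act (tab_word U) (insert ?s \<delta>) = insert ?s (word_act (tab_word U) \<delta>)"
      "?s \<notin> word_act (tab_word U) \<delta>" if "n_tableau ?R U" for U
    proof -
      have l: "tab_word U \<in> lists ?R" using that R by (intro tab_word_in_lists) auto
      show "word_act (tab_word U) (insert ?s \<delta>) = insert ?s (word_act (tab_word U) \<delta>)"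
        using l less fd by (intro word_act_insert_less) auto
      show "?s \<notin> word_act (tab_word U) \<delta>"
        using word_act_closed[OF l \<delta>] by auto
    qed
    ultimately show ?thesis using S R(4) by (metis insert_ident)
  qed
  then have "T = S" using 2(1)[of S] R S by auto
  then show ?case using T' by simp
qed

section \<open>Counting\<close>

text \<open>The index \<open>S\<close> is the complement in \<open>Y\<close> of the block of
  \<open>b\<close>, not the block itself; this matches the first rows in the recursion for
  tableaux.\<close>

lemma bij_betw_partitions_insert:
  assumes "b \<notin> Y"
  shows "bij_betw (\<lambda>(S, Q). insert (insert b (Y - S)) Q)
    (SIGMA S:Pow Y. {Q. partition_on S Q}) {P. partition_on (insert b Y) P}"
proof (rule bij_betwI')
  have nb: "b \<notin> \<Union>Q" if "partition_on S Q" "S \<subseteq> Y" for S Q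
    using that assms partition_onD1 by blast
  fix x assume "x \<in> (SIGMA S:Pow Y. {Q. partition_on S Q})"
  then obtain S Q where x: "x = (S, Q)" "S \<subseteq> Y" "partition_on S Q" by auto
  have "disjnt (insert b (Y - S)) (\<Union>Q)"
    using nb[OF x(3,2)] x(3) by (auto simp: disjnt_def dest: partition_onD1)
  moreover have "insert b Y - insert b (Y - S) = S" using x(2) assms by auto
  ultimately have "partition_on (insert b Y) (insert (insert b (Y - S)) Q)"
    using partition_on_insert x(3) by (metis Diff_subset insert_mono insert_not_empty)
  then show "(case x of (S, Q) \<Rightarrow> insert (insert b (Y - S)) Q) \<in> {P. partition_on (insert b Y) P}"
    by (simp add: x(1))
  fix x' assume "x' \<in> (SIGMA S:Pow Y. {Q. partition_on S Q})"
  then obtain S' Q' where x': "x' = (S', Q')" "S' \<subseteq> Y" "partition_on S' Q'" by auto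
  have "S = S' \<and> Q = Q'" if eq: "insert (insert b (Y - S)) Q = insert (insert b (Y - S')) Q'"
  proof -
    have "insert b (Y - S) \<notin> Q" "insert b (Y - S) \<notin> Q'" "insert b (Y - S') \<notin> Q'"
      using nb[OF x(3,2)] nb[OF x'(3,2)] by auto
    moreover from this have B: "insert b (Y - S) = insert b (Y - S')"
      using eq by blast
    ultimately have "Q = Q'" using eq by (simp add: insert_ident)
    moreover have "Y - S = Y - S'" using B assms by (simp add: insert_ident)
    then have "S = S'" using x(2) x'(2) by (metis double_diff order_refl)
    ultimately show ?thesis by simp
  qed
  then show "((case x of (S, Q) \<Rightarrow> insert (insert b (Y - S)) Q) =
      (case x' of (S, Q) \<Rightarrow> insert (insert b (Y - S)) Q)) = (x = x')"
    using x(1) x'(1) by auto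
next
  fix P assume "P \<in> {P. partition_on (insert b Y) P}"
  then have P: "partition_on (insert b Y) P" by simp
  then obtain B where B: "B \<in> P" "b \<in> B" "B \<subseteq> insert b Y"
    using partition_onD1[OF P] by auto
  have ins: "insert B (P - {B}) = P" using B by blast
  have "disjnt B (\<Union>(P - {B}))"
    using partition_onD2[OF P] B by (auto simp: disjnt_def disjoint_def)
  moreover have "insert b Y - B = Y - B" using B by auto
  ultimately have "partition_on (Y - B) (P - {B})"
    using partition_on_insert[of B "P - {B}" "insert b Y"] P ins by simp
  moreover have "insert b (Y - (Y - B)) = B" using B by auto
  ultimately show "\<exists>x\<in>SIGMA S:Pow Y. {Q. partition_on S Q}.
      P = (case x of (S, Q) \<Rightarrow> insert (insert b (Y - S)) Q)"
    using ins by (intro bexI[of _ "(Y - B, P - {B})"]) auto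
qed

lemma card_partitions_insert:
  assumes "finite Y" "b \<notin> Y"
  shows "card {P. partition_on (insert b Y) P} = (\<Sum>S\<in>Pow Y. card {P. partition_on S P})"
proof -
  have "finite {P. partition_on S P}" if "S \<in> Pow Y" for S
    using that assms(1) finite_subset finitely_many_partition_on by blast
  then have "card (SIGMA S:Pow Y. {Q. partition_on S Q}) = (\<Sum>S\<in>Pow Y. card {P. partition_on S P})"
    using assms(1) by (intro card_SigmaI) auto
  then show ?thesis
    using bij_betw_same_card[OF bij_betw_partitions_insert[OF assms(2)]] by simp
qed

text \<open>The first component is the first row, with \<open>{}\<close> standing for the tableau
  without rows; since rows are never empty, the coding is unambiguous.\<close>

lemma bij_betw_n_tableau:
  "bij_betw (\<lambda>(R, T). if R = {} then [] else R # T)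
    (SIGMA R:Pow A. if R = {} then {[]} else {T. n_tableau (R - {Min R}) T}) {T. n_tableau A T}"
  (is "bij_betw ?f ?D _")
proof (rule bij_betw_imageI)
  show "inj_on ?f ?D"
    by (rule inj_onI) (auto split: if_splits)
  have "T \<in> ?f ` ?D" if "n_tableau A T" for T
  proof (cases T)
    case Nil
    then show ?thesis by (intro image_eqI[of _ _ "({}, [])"]) auto
  next
    case (Cons R T')
    then show ?thesis using that by (intro image_eqI[of _ _ "(R, T')"]) auto
  qed
  moreover have "n_tableau A (?f x)" if "x \<in> ?D" for x
    using that by (cases x) (simp split: if_splits)
  ultimately show "?f ` ?D = {T. n_tableau A T}" by blast
qed

lemma finite_n_tableau:
  assumes "finite A"
  shows "finite {T. n_tableau A T}"
  using assms
proof (induction A rule: finite_psubset_induct)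
  case (psubset A)
  have "finite {T. n_tableau (R - {Min R}) T}" if "R \<in> Pow A" "R \<noteq> {}" for R
  proof (rule psubset.IH)
    have "finite R" using that psubset.hyps finite_subset by blast
    then have "Min R \<in> R" using that by simp
    then show "R - {Min R} \<subset> A" using that by blast
  qed
  then have "finite (SIGMA R:Pow A. if R = {} then {[]} else {T. n_tableau (R - {Min R}) T})"
    using psubset.hyps by (intro finite_SigmaI) auto
  then show ?case
    using bij_betw_finite[OF bij_betw_n_tableau] by blast
qed

lemma card_n_tableau:
  assumes "finite A"
  shows "card {T. n_tableau A T} =
    (\<Sum>R\<in>Pow A. if R = {} then 1 else card {T. n_tableau (R - {Min R}) T})"
proof -
  let ?B = "\<lambda>R. if R = {} then {[]} else {T. n_tableau (R - {Min R}) T}"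
  have "finite (?B R)" if "R \<in> Pow A" for R
    using finite_n_tableau[of "R - {Min R}"] finite_subset[of R A] that assms by simp
  then have "card (Sigma (Pow A) ?B) = (\<Sum>R\<in>Pow A. card (?B R))"
    using assms by (intro card_SigmaI) auto
  also have "\<dots> = (\<Sum>R\<in>Pow A. if R = {} then 1 else card {T. n_tableau (R - {Min R}) T})"
    by (intro sum.cong) auto
  finally show ?thesis
    using bij_betw_same_card[OF bij_betw_n_tableau[of A]] by simp
qed

text \<open>Both sides obey the same recursion over subsets. The shift by one reproduces itself: a
  row \<open>R\<close> leaves an alphabet with one letter fewer than \<open>R\<close>, so the tails
  correspond to partitions of a copy of \<open>R\<close>. \<open>X\<close> varies because this copy
  is the image of \<open>R\<close> under \<open>f\<close>.\<close>

lemma card_n_tableau_eq_partitions: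
  fixes A :: "'a::linorder set" and X :: "'b set"
  assumes "finite A" "finite X" "card X = Suc (card A)"
  shows "card {T. n_tableau A T} = card {P. partition_on X P}"
  using assms
proof (induction A arbitrary: X rule: finite_psubset_induct)
  case (psubset A)
  obtain b Y where X: "X = insert b Y" "b \<notin> Y" "card Y = card A" "finite Y"
    using psubset.prems by (metis card_Suc_eq finite_insert)
  obtain f where f: "bij_betw f A Y"
    using psubset.hyps X finite_same_card_bij by metis
  have step: "(if R = {} then 1 else card {T. n_tableau (R - {Min R}) T}) =
      card {P. partition_on (f ` R) P}" if "R \<in> Pow A" for R
  proof (cases "R = {}")
    case True
    \<comment> \<open>The tableau without rows matches the single partition of the empty
      set.\<close>
    then show ?thesis by (simp add: partition_on_empty)
  next
    case False
    have fin: "finite R" using that psubset.hyps finite_subset by blast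
    have Min: "Min R \<in> R" using False fin by simp
    have "inj_on f R" using f that by (meson PowD bij_betw_def inj_on_subset)
    then have "card (f ` R) = Suc (card (R - {Min R}))"
      using fin Min by (metis card_Suc_Diff1 card_image)
    then have "card {T. n_tableau (R - {Min R}) T} = card {P. partition_on (f ` R) P}"
      using Min that fin by (intro psubset.IH) auto
    then show ?thesis using False by simp
  qed
  have "card {T. n_tableau A T} = (\<Sum>R\<in>Pow A. card {P. partition_on (f ` R) P})"
    unfolding card_n_tableau[OF psubset.hyps] by (rule sum.cong[OF HOL.refl step])
  also have "\<dots> = (\<Sum>S\<in>Pow Y. card {P. partition_on S P})"
    by (intro sum.reindex_bij_betw bij_betw_Pow f)
  also have "\<dots> = card {P. partition_on X P}"
    unfolding X(1) by (rule card_partitions_insert[OF X(4,2), symmetric])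
  finally show ?case .
qed

section \<open>The presentation\<close>

lemma styl_map_eq_if_cong:
  assumes "finite A" "(u, v) \<in> styl_cong A"
  shows "styl_map A u = styl_map A v"
  unfolding styl_map_eq_iff
proof
  fix \<gamma> assume "\<gamma> \<in> Pow A"
  then have "finite \<gamma>" using assms(1) finite_subset by blast
  then show "word_act u \<gamma> = word_act v \<gamma>" by (rule word_act_styl_cong[OF assms(2)])
qed

text \<open>Words with the same map have normal forms with the same map, hence one and the same
  normal form, which links them in the congruence.\<close>

lemma styl_map_eq_iff_cong:
  assumes "finite A" "u \<in> lists A" "v \<in> lists A"
  shows "styl_map A u = styl_map A v \<longleftrightarrow> (u, v) \<in> styl_cong A"
proof
  assume "(u, v) \<in> styl_cong A"
  then show "styl_map A u = styl_map A v" by (rule styl_map_eq_if_cong[OF assms(1)])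
next
  assume eq: "styl_map A u = styl_map A v"
  obtain T where T: "n_tableau A T" "(u, tab_word T) \<in> styl_cong A"
    using ex_tableau[OF assms(1,2)] by blast
  obtain T' where T': "n_tableau A T'" "(v, tab_word T') \<in> styl_cong A"
    using ex_tableau[OF assms(1,3)] by blast
  have "styl_map A (tab_word T) = styl_map A (tab_word T')"
    using styl_map_eq_if_cong[OF assms(1) T(2)] styl_map_eq_if_cong[OF assms(1) T'(2)] eq by simp
  then have "T = T'" using tab_word_inject[OF assms(1) T(1) T'(1)] by (simp add: styl_map_eq_iff)
  then show "(u, v) \<in> styl_cong A"
    using gen_cong.trans[OF T(2)] gen_cong.sym[OF T'(2)] by simp
qed

lemma card_Styl:
  assumes "finite A"
  shows "card (carrier (Styl A)) = card {T. n_tableau A T}"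
proof -
  have "bij_betw (\<lambda>T. styl_map A (tab_word T)) {T. n_tableau A T} (carrier (Styl A))"
  proof (rule bij_betw_imageI)
    show "inj_on (\<lambda>T. styl_map A (tab_word T)) {T. n_tableau A T}"
    proof (rule inj_onI)
      fix T T' assume "T \<in> {T. n_tableau A T}" "T' \<in> {T. n_tableau A T}"
        "styl_map A (tab_word T) = styl_map A (tab_word T')"
      then show "T = T'"
        unfolding styl_map_eq_iff using tab_word_inject[OF assms] by blast
    qed
    have "styl_map A w \<in> (\<lambda>T. styl_map A (tab_word T)) ` {T. n_tableau A T}" if "w \<in> lists A" for w
    proof -
      obtain T where T: "n_tableau A T" "(w, tab_word T) \<in> styl_cong A"
        using ex_tableau[OF assms \<open>w \<in> lists A\<close>] by blast
      from styl_map_eq_if_cong[OF assms T(2)] show ?thesis using T(1) by blast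
    qed
    moreover have "styl_map A (tab_word T) \<in> styl_map A ` lists A" if "n_tableau A T" for T
      using tab_word_in_lists[OF that assms] by (rule imageI)
    ultimately show "(\<lambda>T. styl_map A (tab_word T)) ` {T. n_tableau A T} = carrier (Styl A)"
      unfolding Styl_def monoid.simps partial_object.simps by blast
  qed
  then show ?thesis by (rule bij_betw_same_card[symmetric])
qed

lemma Styl_has_presentation:
  assumes "finite A"
  shows "has_presentation (Styl A) (\<lambda>x. styl_map A [x]) A (styl_rels A)"
proof -
  let ?M = "presented_monoid A (styl_rels A)" and ?c = "\<lambda>u. styl_cong A `` {u}"
  \<comment> \<open>A representative is picked by choice; the fact \<open>h\<close> shows that the
    result depends only on the class.\<close>
  define h where "h C = styl_map A (SOME w. w \<in> C)" for C
  have h: "h (?c w) = styl_map A w" if "w \<in> lists A" for w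
  proof -
    have "w \<in> ?c w" using gen_cong.refl[OF that] by (rule ImageI) simp
    then have "(SOME v. v \<in> ?c w) \<in> ?c w" by (rule someI)
    then have "(w, SOME v. v \<in> ?c w) \<in> styl_cong A" by simp
    then show ?thesis
      unfolding h_def by (rule styl_map_eq_if_cong[OF assms, symmetric])
  qed
  have carr: "carrier ?M = ?c ` lists A"
    by (auto simp: presented_monoid_def quotient_def)
  have carr_Styl: "carrier (Styl A) = styl_map A ` lists A"
    by (simp add: Styl_def)
  have "h \<in> hom ?M (Styl A)"
  proof (rule homI)
    fix C D assume "C \<in> carrier ?M" "D \<in> carrier ?M"
    then obtain u v where u: "u \<in> lists A" "C = ?c u" and v: "v \<in> lists A" "D = ?c v"
      unfolding carr by blast
    show "h C \<in> carrier (Styl A)"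
      unfolding u(2) h[OF u(1)] carr_Styl using u(1) by (rule imageI)
    have uv: "u @ v \<in> lists A" using u(1) v(1) by simp
    have "h (C \<otimes>\<^bsub>?M\<^esub> D) = styl_map A (u @ v)"
      unfolding u(2) v(2) presented_monoid_mult[OF styl_rels_subset u(1) v(1)] by (rule h[OF uv])
    also have "\<dots> = h C \<otimes>\<^bsub>Styl A\<^esub> h D"
      unfolding u(2) v(2) h[OF u(1)] h[OF v(1)] styl_map_append[OF v(1)] by (simp add: Styl_def)
    finally show "h (C \<otimes>\<^bsub>?M\<^esub> D) = h C \<otimes>\<^bsub>Styl A\<^esub> h D" .
  qed
  moreover have "bij_betw h (carrier ?M) (carrier (Styl A))"
  proof (rule bij_betw_imageI)
    show "h ` carrier ?M = carrier (Styl A)"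
      unfolding carr image_image carr_Styl by (intro image_cong HOL.refl h)
    show "inj_on h (carrier ?M)"
    proof (rule inj_onI)
      fix C D assume "C \<in> carrier ?M" "D \<in> carrier ?M" and eq: "h C = h D"
      then obtain u v where u: "u \<in> lists A" "C = ?c u" and v: "v \<in> lists A" "D = ?c v"
        unfolding carr by blast
      have "styl_map A u = styl_map A v"
        using eq unfolding u(2) v(2) h[OF u(1)] h[OF v(1)] .
      then have "(u, v) \<in> styl_cong A"
        by (simp only: styl_map_eq_iff_cong[OF assms u(1) v(1)])
      then show "C = D"
        unfolding u(2) v(2) by (rule equiv_class_eq[OF equiv_gen_cong[OF styl_rels_subset]])
    qed
  qed
  ultimately have "h \<in> iso ?M (Styl A)" by (rule isoI)
  moreover have "\<forall>x\<in>A. h (?c [x]) = styl_map A [x]"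
    by (intro ballI h) simp
  ultimately show ?thesis unfolding has_presentation_def by (intro bexI)
qed

theorem theorem8p1:
  fixes A :: "'a::linorder set" and n :: nat
  assumes "finite A" and "card A = n"
  shows "card (carrier (Styl A)) = bell (n + 1) \<and>
    has_presentation (Styl A) (\<lambda>x. styl_map A [x]) A (plactic_rels A \<union> idempotent_rels A)"
proof
  show "card (carrier (Styl A)) = bell (n + 1)"
    \<comment> \<open>\<open>{..<n + 1}\<close> is the set partitioned in
      \<open>bell (n + 1)\<close>; it has one element more than \<open>A\<close>.\<close>
    using card_n_tableau_eq_partitions[of A "{..<n + 1}"] assms
    by (simp add: card_Styl bell_def)
  show "has_presentation (Styl A) (\<lambda>x. styl_map A [x]) A (styl_rels A)"
    using assms(1) by (rule Styl_has_presentation)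
qed

end
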